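(* Let $\phi\in\mathfrak F$ be a polynomial in the indeterminates $(X_{ij})_{i,j=1}^n$ of degree $d\ge1$. Let $M(\phi)$ be the maximal coefficient (in absolute value) of $\phi$, and $N(\phi)$ the number of monomials in $\phi$ (with non-zero coefficient). Then for all integers $k\ge0$, $$\|D^k\phi\|_\infty\le 2^k\,M(\phi)\,N(\phi),\qquad \|U\phi\|_\infty\le\frac{d-1}{n}\,M(\phi)\,N(\phi).$$
   Context: $[n]=\{1,\dots,n\}$; $\mathfrak S_n$ is the symmetric group on $[n]$. A permutation $\sigma$ is identified with its matrix $S$, $S_{ij}=\mathbf 1_{\sigma(i)=j}$, so a function on $M_n(\mathbb R)$ can be evaluated at $\sigma$. $\partial_{ij}$ is the partial derivative with respect to the entry $(i,j)$. Let $$\mathfrak F=\{\phi:M_n(\mathbb R)\to\mathbb R\ :\ \forall i,j,k\in[n],\ \partial_{ij}\partial_{ik}\phi\equiv\partial_{ji}\partial_{ki}\phi\equiv0\}.$$ These are polynomials in indeterminates $X_{ij}$, each of whose monomials contains at most one indeterminate (to the first power) from each row and each column. $\mathfrak F_{=d}$ is the subspace of homogeneous polynomials of degree $d$ in $\mathfrak F$. Linear operators $D,U$ on $\mathfrak F$ are defined on homogeneous $\phi\in\mathfrak F_{=d}$, $d\ge1$, by $$D\phi=\frac1{dn}\sum_{i,j\in[n]}\partial_{ij}\phi,\qquad U\phi(X)=\frac1{dn}\sum_{i,j,k,l\in[n]}X_{il}X_{kj}\,\partial_{ij}\partial_{kl}\phi(X),$$ with $D\phi=U\phi=0$ for constant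 $\phi$, and extended by linearity. $\|\phi\|_\infty=\max_{\sigma\in\mathfrak S_n}|\phi(\sigma)|$. *)

theory Defs
  imports "HOL-Analysis.Analysis" "HOL-Library.Poly_Mapping"
begin

text \<open>
  The index set \<open>[n]\<close> is a finite type \<open>'n\<close>, with \<open>n = CARD('n)\<close>; \<open>X $ i $ j\<close> is the entry of
  the matrix \<open>X\<close> in row \<open>i\<close> and column \<open>j\<close>.
\<close>

type_synonym 'n matfun = "real^'n^'n \<Rightarrow> real"

definition pd :: "'n::finite \<Rightarrow> 'n \<Rightarrow> 'n matfun \<Rightarrow> 'n matfun" where
  "pd i j \<phi> = (\<lambda>X. deriv (\<lambda>t::real. \<phi> (X + t *\<^sub>R axis i (axis j 1))) 0)"

definition pd_exists :: "'n::finite \<Rightarrow> 'n \<Rightarrow> 'n matfun \<Rightarrow> bool" where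
  "pd_exists i j \<phi> \<longleftrightarrow>
     (\<forall>X. (\<lambda>t::real. \<phi> (X + t *\<^sub>R axis i (axis j 1))) field_differentiable at 0)"

text \<open>
  Since \<^const>\<open>deriv\<close> is total, an equation between partial derivatives does not entail that
  they exist, so existence is required explicitly. The case \<open>j = k\<close> makes every member of \<open>\<FF>\<close>
  affine in each entry separately, hence a polynomial function.
\<close>

definition pd2_vanishes :: "'n::finite \<Rightarrow> 'n \<Rightarrow> 'n \<Rightarrow> 'n \<Rightarrow> 'n matfun \<Rightarrow> bool" where
  "pd2_vanishes i j k l \<phi> \<longleftrightarrow>
     pd_exists k l \<phi> \<and> pd_exists i j (pd k l \<phi>) \<and> (\<forall>X. pd i j (pd k l \<phi>) X = 0)"

definition FF :: "('n::finite) matfun set" where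
  "FF = {\<phi>. \<forall>i j k. pd2_vanishes i j i k \<phi> \<and> pd2_vanishes j i k i \<phi>}"

text \<open>
  A monomial is the finitely supported map sending \<open>(i, j)\<close> to the exponent of \<open>X\<^sub>i\<^sub>j\<close>, and a
  polynomial is a finitely supported map from monomials to coefficients.
\<close>

type_synonym 'n monomial = "('n \<times> 'n) \<Rightarrow>\<^sub>0 nat"
type_synonym 'n polynomial = "'n monomial \<Rightarrow>\<^sub>0 real"

definition eval_monomial :: "('n::finite) monomial \<Rightarrow> 'n matfun" where
  "eval_monomial m X = (\<Prod>(i, j)\<in>UNIV. X $ i $ j ^ Poly_Mapping.lookup m (i, j))"

definition eval_polynomial :: "('n::finite) polynomial \<Rightarrow> 'n matfun" where
  "eval_polynomial p X = (\<Sum>m\<in>Poly_Mapping.keys p. Poly_Mapping.lookup p m * eval_monomial m X)"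

definition monomial_degree :: "('n::finite) monomial \<Rightarrow> nat" where
  "monomial_degree m = (\<Sum>x\<in>UNIV. Poly_Mapping.lookup m x)"

text \<open>
  A polynomial function on real matrices is induced by exactly one polynomial, so the following
  notions are meaningful on all polynomial functions, in particular on \<^const>\<open>FF\<close>.
\<close>

definition polynomial_of :: "('n::finite) matfun \<Rightarrow> 'n polynomial" where
  "polynomial_of \<phi> = (THE p. \<phi> = eval_polynomial p)"

definition total_degree :: "('n::finite) matfun \<Rightarrow> nat" where
  "total_degree \<phi> = Max (insert 0 (monomial_degree ` Poly_Mapping.keys (polynomial_of \<phi>)))"

definition max_coeff :: "('n::finite) matfun \<Rightarrow> real" where
  "max_coeff \<phi> = Max (insert 0 ((\<lambda>m. \<bar>Poly_Mapping.lookup (polynomial_of \<phi>) m\<bar>) ` Poly_Mapping.keys (polynomial_of \<phi>)))"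

definition num_monomials :: "('n::finite) matfun \<Rightarrow> nat" where
  "num_monomials \<phi> = card (Poly_Mapping.keys (polynomial_of \<phi>))"

definition hom_component :: "nat \<Rightarrow> ('n::finite) matfun \<Rightarrow> 'n matfun" where
  "hom_component d \<phi> X =
     (\<Sum>m\<in>{m \<in> Poly_Mapping.keys (polynomial_of \<phi>). monomial_degree m = d}.
        Poly_Mapping.lookup (polynomial_of \<phi>) m * eval_monomial m X)"

text \<open>
  \<open>D_hom d\<close> and \<open>U_hom d\<close> are the defining formulas on homogeneous polynomials of degree
  \<open>d \<ge> 1\<close>. The operators are their linear extensions: the homogeneous components are treated
  separately, and the component of degree \<open>0\<close> is mapped to \<open>0\<close>.
\<close>

definition D_hom :: "nat \<Rightarrow> ('n::finite) matfun \<Rightarrow> 'n matfun" where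
  "D_hom d \<phi> X = 1 / (real d * real CARD('n)) * (\<Sum>i\<in>UNIV. \<Sum>j\<in>UNIV. pd i j \<phi> X)"

definition U_hom :: "nat \<Rightarrow> ('n::finite) matfun \<Rightarrow> 'n matfun" where
  "U_hom d \<phi> X = 1 / (real d * real CARD('n)) *
     (\<Sum>i\<in>UNIV. \<Sum>j\<in>UNIV. \<Sum>k\<in>UNIV. \<Sum>l\<in>UNIV. X $ i $ l * X $ k $ j * pd i j (pd k l \<phi>) X)"

definition D_op :: "('n::finite) matfun \<Rightarrow> 'n matfun" where
  "D_op \<phi> X = (\<Sum>d = 1..total_degree \<phi>. D_hom d (hom_component d \<phi>) X)"

definition U_op :: "('n::finite) matfun \<Rightarrow> 'n matfun" where
  "U_op \<phi> X = (\<Sum>d = 1..total_degree \<phi>. U_hom d (hom_component d \<phi>) X)"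

definition perm_matrix :: "('n::finite \<Rightarrow> 'n) \<Rightarrow> real^'n^'n" where
  "perm_matrix \<sigma> = (\<chi> i j. if \<sigma> i = j then 1 else 0)"

definition sup_norm :: "('n::finite) matfun \<Rightarrow> real" where
  "sup_norm \<phi> = Max ((\<lambda>\<sigma>. \<bar>\<phi> (perm_matrix \<sigma>)\<bar>) ` {\<sigma>. \<sigma> permutes UNIV})"

end

theory Submission
  imports Defs
begin

text \<open>
  Let \<open>L\<close> be the sum of the absolute values of the coefficients of a polynomial. The entries of a
  permutation matrix are \<open>0\<close> or \<open>1\<close>, so \<open>L\<close> bounds the supremum norm, and \<open>L \<le> M N\<close>. The partial
  derivatives of a monomial of degree \<open>d\<close> have coefficients of total weight \<open>d\<close>, and its second
  partial derivatives of total weight \<open>d (d - 1)\<close>. Hence \<open>D\<close> multiplies \<open>L\<close> by at most \<open>1 / n\<close>,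
  and \<open>U\<close> is bounded at permutation matrices by \<open>(d - 1) / n\<close> times \<open>L\<close>.
\<close>

section \<open>Sums of coefficients, and evaluation of formal sums of terms\<close>

definition coeff_norm :: "('n::finite) polynomial \<Rightarrow> real" where
  "coeff_norm p = (\<Sum>m\<in>Poly_Mapping.keys p. \<bar>Poly_Mapping.lookup p m\<bar>)"

text \<open>Coefficients vanish off the keys. Passing to a common finite index set lets polynomials
  with different supports be treated termwise.\<close>

lemma eval_polynomial_superset:
  assumes "finite A" "Poly_Mapping.keys p \<subseteq> A"
  shows "eval_polynomial p X = (\<Sum>m\<in>A. Poly_Mapping.lookup p m * eval_monomial m X)"
  unfolding eval_polynomial_def
  by (rule sum.mono_neutral_left) (use assms in \<open>auto simp: in_keys_iff\<close>)

lemma coeff_norm_superset: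
  assumes "finite A" "Poly_Mapping.keys p \<subseteq> A"
  shows "coeff_norm p = (\<Sum>m\<in>A. \<bar>Poly_Mapping.lookup p m\<bar>)"
  unfolding coeff_norm_def
  by (rule sum.mono_neutral_left) (use assms in \<open>auto simp: in_keys_iff\<close>)

lemma eval_polynomial_add:
  "eval_polynomial (p + q) X = eval_polynomial p X + eval_polynomial q X"
proof -
  let ?A = "Poly_Mapping.keys p \<union> Poly_Mapping.keys q"
  have "Poly_Mapping.keys (p + q) \<subseteq> ?A" by (rule Poly_Mapping.keys_add)
  then show ?thesis
    by (simp add: eval_polynomial_superset[of ?A] lookup_add algebra_simps sum.distrib)
qed

lemma coeff_norm_add: "coeff_norm (p + q) \<le> coeff_norm p + coeff_norm q"
proof -
  let ?A = "Poly_Mapping.keys p \<union> Poly_Mapping.keys q"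
  have "Poly_Mapping.keys (p + q) \<subseteq> ?A" by (rule Poly_Mapping.keys_add)
  then have "coeff_norm (p + q) = (\<Sum>m\<in>?A. \<bar>Poly_Mapping.lookup p m + Poly_Mapping.lookup q m\<bar>)"
    by (simp add: coeff_norm_superset[of ?A] lookup_add)
  also have "\<dots> \<le> (\<Sum>m\<in>?A. \<bar>Poly_Mapping.lookup p m\<bar> + \<bar>Poly_Mapping.lookup q m\<bar>)"
    by (intro sum_mono abs_triangle_ineq)
  also have "\<dots> = coeff_norm p + coeff_norm q"
    by (simp add: coeff_norm_superset[of ?A] sum.distrib)
  finally show ?thesis .
qed

lemma eval_polynomial_sum_single:
  assumes "finite A"
  shows "eval_polynomial (\<Sum>a\<in>A. Poly_Mapping.single (f a) (c a)) X
           = (\<Sum>a\<in>A. c a * eval_monomial (f a) X)"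
  using assms
proof induction
  case empty
  show ?case by (simp add: eval_polynomial_def)
next
  case (insert a A)
  then show ?case
    by (simp add: eval_polynomial_add eval_polynomial_superset[of "{f a}"])
qed

text \<open>Only an inequality, because \<open>f\<close> need not be injective: terms with the same
  monomial merge and may cancel. This happens for derivatives of distinct monomials.\<close>

lemma coeff_norm_sum_single:
  assumes "finite A"
  shows "coeff_norm (\<Sum>a\<in>A. Poly_Mapping.single (f a) (c a)) \<le> (\<Sum>a\<in>A. \<bar>c a\<bar>)"
  using assms
proof induction
  case empty
  show ?case by (simp add: coeff_norm_def)
next
  case (insert a A)
  have "coeff_norm (Poly_Mapping.single (f a) (c a)) = \<bar>c a\<bar>"
    by (simp add: coeff_norm_superset[of "{f a}"])
  with insert show ?case
    by (simp add: order_trans[OF coeff_norm_add])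
qed

subsection \<open>Uniqueness of coefficients\<close>

lemma eval_monomial_times:
  "eval_monomial m (\<chi> i j. X $ i $ j * Y $ i $ j) = eval_monomial m X * eval_monomial m Y"
  by (simp add: eval_monomial_def power_mult_distrib case_prod_beta prod.distrib)

lemma eval_monomial_ones: "eval_monomial m (\<chi> i j. 1) = 1"
  by (simp add: eval_monomial_def case_prod_beta)

lemma eval_monomial_separates:
  assumes "m \<noteq> m'"
  obtains Y where "eval_monomial m Y \<noteq> eval_monomial m' Y"
proof -
  obtain i j where ij: "Poly_Mapping.lookup m (i, j) \<noteq> Poly_Mapping.lookup m' (i, j)"
    using assms by (metis poly_mapping_eqI surj_pair)
  \<comment> \<open>At this matrix a monomial sees only its exponent at \<open>(i, j)\<close>, as a
    power of 2.\<close>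
  define Y :: "real^'a^'a" where "Y = (\<chi> k l. if (k, l) = (i, j) then 2 else 1)"
  have *: "eval_monomial m Y = 2 ^ Poly_Mapping.lookup m (i, j)" for m
  proof -
    have "eval_monomial m Y = (\<Prod>x\<in>UNIV. if x = (i, j) then 2 ^ Poly_Mapping.lookup m x else 1)"
      unfolding eval_monomial_def Y_def
      by (intro prod.cong) (simp_all split: prod.split)
    then show ?thesis by simp
  qed
  have "eval_monomial m Y \<noteq> eval_monomial m' Y"
    unfolding * using ij by simp
  then show ?thesis by (rule that)
qed

text \<open>
  Monomials are pairwise distinct characters of the entrywise multiplicative monoid of matrices,
  so Dedekind's argument applies.
\<close>

lemma eval_monomial_independent:
  assumes "finite A" "\<And>X. (\<Sum>m\<in>A. c m * eval_monomial m X) = 0" "m \<in> A"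
  shows "c m = 0"
  using assms
proof (induction A arbitrary: c m rule: finite_induct)
  case empty
  then show ?case by simp
next
  case (insert a A)
  have zero: "c b = 0" if "b \<in> A" for b
  proof -
    have "b \<noteq> a" using that insert.hyps by blast
    then obtain Y where Y: "eval_monomial b Y \<noteq> eval_monomial a Y"
      by (rule eval_monomial_separates)
    \<comment> \<open>Take the relation at the entrywise product of \<open>X\<close> and
      \<open>Y\<close>, and subtract \<open>eval_monomial a Y\<close> times the relation at
      \<open>X\<close>. The term of \<open>a\<close> cancels, while the factor at \<open>b\<close>
      stays nonzero.\<close>
    let ?c = "\<lambda>m. c m * (eval_monomial m Y - eval_monomial a Y)"
    have "(\<Sum>m\<in>A. ?c m * eval_monomial m X) = 0" for X
    proof -
      have "(\<Sum>m\<in>A. ?c m * eval_monomial m X) = (\<Sum>m\<in>insert a A. ?c m * eval_monomial m X)"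
        using insert.hyps by simp
      also have "\<dots> = (\<Sum>m\<in>insert a A. c m * eval_monomial m (\<chi> i j. X $ i $ j * Y $ i $ j))
            - eval_monomial a Y * (\<Sum>m\<in>insert a A. c m * eval_monomial m X)"
        unfolding sum_distrib_left sum_subtractf[symmetric] eval_monomial_times
        by (intro sum.cong) (auto simp: algebra_simps)
      also have "\<dots> = 0" unfolding insert.prems by simp
      finally show ?thesis .
    qed
    then have "?c b = 0" using insert.IH[of ?c b] that by blast
    with Y show ?thesis by simp
  qed
  \<comment> \<open>Every monomial is 1 at the all-ones matrix, so the remaining coefficient can be
    read off there.\<close>
  then have "(\<Sum>m\<in>A. c m * eval_monomial m (\<chi> i j. 1)) = 0" by simp
  then have "c a = 0"
    using insert.prems(1)[of "\<chi> i j. 1"] insert.hyps by (simp add: eval_monomial_ones)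
  with zero insert.prems(2) show ?case by blast
qed

lemma eval_polynomial_inject:
  assumes "eval_polynomial p = eval_polynomial q"
  shows "p = q"
proof (rule poly_mapping_eqI)
  fix m
  let ?A = "insert m (Poly_Mapping.keys p \<union> Poly_Mapping.keys q)"
  let ?c = "\<lambda>m. Poly_Mapping.lookup p m - Poly_Mapping.lookup q m"
  have "(\<Sum>m\<in>?A. ?c m * eval_monomial m X) = eval_polynomial p X - eval_polynomial q X" for X
    by (subst (1 2) eval_polynomial_superset[of ?A])
      (auto simp only: left_diff_distrib sum_subtractf finite_insert finite_Un finite_keys)
  then have "?c m = 0"
    using assms by (intro eval_monomial_independent[of ?A ?c]) auto
  then show "Poly_Mapping.lookup p m = Poly_Mapping.lookup q m" by simp
qed

text \<open>Injectivity of evaluation makes the definite description proper; degree, coefficients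
  and components of a polynomial function can then be computed from \<open>p\<close>.\<close>

lemma polynomial_of_eval: "polynomial_of (eval_polynomial p) = p"
  unfolding polynomial_of_def by (rule the_equality) (auto dest: eval_polynomial_inject)

subsection \<open>Functions with vanishing second derivatives are polynomial\<close>

definition entry_unit :: "'n::finite \<times> 'n \<Rightarrow> real^'n^'n" where
  "entry_unit x = axis (fst x) (axis (snd x) 1)"

lemma entry_unit_component: "entry_unit x $ i $ j = (if x = (i, j) then 1 else 0)"
  by (auto simp: entry_unit_def axis_def prod_eq_iff)

text \<open>A derivative-free form of affinity, with the slope written as a unit difference. It
  passes to translates of \<open>\<phi>\<close>, which the induction over entries relies on.\<close>

definition affine_in_entries :: "('n::finite) matfun \<Rightarrow> bool" where
  "affine_in_entries \<phi> \<longleftrightarrow>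
     (\<forall>x X t. \<phi> (X + t *\<^sub>R entry_unit x) = \<phi> X + t * (\<phi> (X + entry_unit x) - \<phi> X))"

text \<open>\<open>pd_exists\<close> speaks of the parameter 0 only, but for every base point;
  moving the base point along the line gives every parameter \<open>t\<close>.\<close>

lemma pd_has_field_derivative:
  assumes "pd_exists i j \<phi>"
  shows "((\<lambda>t. \<phi> (X + t *\<^sub>R entry_unit (i, j))) has_field_derivative
           pd i j \<phi> (X + t *\<^sub>R entry_unit (i, j))) (at t)"
proof -
  let ?E = "entry_unit (i, j)"
  have "((\<lambda>s. \<phi> ((X + t *\<^sub>R ?E) + s *\<^sub>R ?E)) has_field_derivative pd i j \<phi> (X + t *\<^sub>R ?E)) (at 0)"
    using assms unfolding pd_exists_def pd_def entry_unit_def fst_conv snd_conv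
    by (simp only: DERIV_deriv_iff_field_differentiable)
  then have "((\<lambda>s. \<phi> (X + (s + t) *\<^sub>R ?E)) has_field_derivative pd i j \<phi> (X + t *\<^sub>R ?E)) (at 0)"
    by (simp add: algebra_simps)
  then show ?thesis
    using DERIV_shift[of "\<lambda>s. \<phi> (X + s *\<^sub>R ?E)" _ 0 t] by simp
qed

lemma FF_affine_in_entries:
  assumes "\<phi> \<in> FF"
  shows "affine_in_entries \<phi>"
  unfolding affine_in_entries_def
proof (intro allI)
  fix x :: "'a \<times> 'a" and X :: "real^'a^'a" and t :: real
  obtain i j where x: "x = (i, j)" by (cases x)
  let ?E = "entry_unit (i, j)"
  \<comment> \<open>These are the instances of \<open>FF\<close> that differentiate twice in the
    same entry.\<close>
  have ex: "pd_exists i j \<phi>" and ex2: "pd_exists i j (pd i j \<phi>)"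
    and zero: "\<And>X. pd i j (pd i j \<phi>) X = 0"
    using assms unfolding FF_def pd2_vanishes_def by auto
  have const: "pd i j \<phi> (X + s *\<^sub>R ?E) = pd i j \<phi> X" for s
  proof -
    have "((\<lambda>s. pd i j \<phi> (X + s *\<^sub>R ?E)) has_field_derivative 0) (at s)" for s
      using pd_has_field_derivative[OF ex2] unfolding zero .
    then have "pd i j \<phi> (X + s *\<^sub>R ?E) = pd i j \<phi> (X + 0 *\<^sub>R ?E)"
      by (intro DERIV_isconst_all allI)
    then show ?thesis by simp
  qed
  have "((\<lambda>s. \<phi> (X + s *\<^sub>R ?E) - s * pd i j \<phi> X) has_field_derivative 0) (at s)" for s
    using pd_has_field_derivative[OF ex, of X s] unfolding const
    by (auto intro!: derivative_eq_intros)
  then have "\<phi> (X + s *\<^sub>R ?E) - s * pd i j \<phi> X = \<phi> (X + 0 *\<^sub>R ?E) - 0 * pd i j \<phi> X" for s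
    by (intro DERIV_isconst_all allI)
  then have lin: "\<phi> (X + s *\<^sub>R ?E) = \<phi> X + s * pd i j \<phi> X" for s
    by (simp add: algebra_simps)
  show "\<phi> (X + t *\<^sub>R entry_unit x) = \<phi> X + t * (\<phi> (X + entry_unit x) - \<phi> X)"
    using lin[of t] lin[of 1] by (simp add: x)
qed

lemma eval_monomial_split:
  "eval_monomial m X = X $ i $ j ^ Poly_Mapping.lookup m (i, j) *
     (\<Prod>x\<in>UNIV - {(i, j)}. X $ fst x $ snd x ^ Poly_Mapping.lookup m x)"
  unfolding eval_monomial_def case_prod_beta by (subst prod.remove[of _ "(i, j)"]) auto

lemma eval_monomial_times_entry:
  "eval_monomial (m + Poly_Mapping.single (i, j) 1) X = X $ i $ j * eval_monomial m X"
proof -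
  have "(\<Prod>x\<in>UNIV - {(i, j)}. X $ fst x $ snd x ^ Poly_Mapping.lookup (m + Poly_Mapping.single (i, j) 1) x)
      = (\<Prod>x\<in>UNIV - {(i, j)}. X $ fst x $ snd x ^ Poly_Mapping.lookup m x)"
    by (intro prod.cong) (auto simp: lookup_add lookup_single)
  then show ?thesis
    by (simp add: eval_monomial_split[of _ X i j] lookup_add)
qed

text \<open>Linear interpolation in one entry, from \<open>p\<close> at 0 to \<open>q\<close> at 1,
  stays polynomial. This is the shape of the formula in \<open>affine_in_entries\<close>.\<close>

lemma polynomial_function_combination:
  fixes p q :: "('n::finite) polynomial"
  obtains r where "\<And>X. eval_polynomial r X
    = eval_polynomial p X + X $ i $ j * (eval_polynomial q X - eval_polynomial p X)"
proof -
  let ?s = "Poly_Mapping.single (i, j) (1::nat)"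
  let ?r1 = "\<Sum>m\<in>Poly_Mapping.keys q. Poly_Mapping.single (m + ?s) (Poly_Mapping.lookup q m)"
  let ?r2 = "\<Sum>m\<in>Poly_Mapping.keys p. Poly_Mapping.single (m + ?s) (- Poly_Mapping.lookup p m)"
  have "eval_polynomial (p + ?r1 + ?r2) X
      = eval_polynomial p X + X $ i $ j * (eval_polynomial q X - eval_polynomial p X)" for X
    unfolding eval_polynomial_add eval_polynomial_sum_single[OF finite_keys]
      eval_monomial_times_entry
    by (simp add: eval_polynomial_def right_diff_distrib sum_distrib_left sum_negf mult_ac)
  then show ?thesis by (rule that)
qed

text \<open>Start from the zero matrix and release the entries one at a time. Each release
  interpolates between two functions already known to be polynomial.\<close>

lemma affine_in_entries_polynomial:
  fixes \<phi> :: "('n::finite) matfun"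
  assumes "affine_in_entries \<phi>"
  obtains p where "\<phi> = eval_polynomial p"
proof -
  define Z :: "('n \<times> 'n) set \<Rightarrow> real^'n^'n \<Rightarrow> real^'n^'n"
    where "Z V X = (\<chi> i j. if (i, j) \<in> V then X $ i $ j else 0)" for V X
  have "\<exists>p. \<forall>X. \<phi> (Z V X) = eval_polynomial p X" if "finite V" for V
    using that assms
  proof (induction V arbitrary: \<phi> rule: finite_induct)
    case empty
    have "eval_polynomial (Poly_Mapping.single 0 (\<phi> 0)) X = \<phi> (Z {} X)" for X
      by (simp add: eval_polynomial_superset[of "{0}"] eval_monomial_def Z_def zero_vec_def)
    then show ?case by metis
  next
    case (insert x V)
    \<comment> \<open>The endpoint at 1 is a translate of \<open>\<phi>\<close>, so the induction is
      over all \<open>\<phi>\<close> that are affine in each entry.\<close>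
    let ?\<psi> = "\<lambda>X. \<phi> (X + entry_unit x)"
    obtain i j where x: "x = (i, j)" by (cases x)
    have "affine_in_entries ?\<psi>"
      unfolding affine_in_entries_def
    proof (intro allI)
      fix y X t
      have "\<phi> ((X + entry_unit x) + t *\<^sub>R entry_unit y) = \<phi> (X + entry_unit x)
          + t * (\<phi> ((X + entry_unit x) + entry_unit y) - \<phi> (X + entry_unit x))"
        using insert.prems unfolding affine_in_entries_def by blast
      then show "\<phi> (X + t *\<^sub>R entry_unit y + entry_unit x) = \<phi> (X + entry_unit x)
          + t * (\<phi> (X + entry_unit y + entry_unit x) - \<phi> (X + entry_unit x))"
        by (simp only: add_ac)
    qed
    then obtain q where q: "\<And>X. \<phi> (Z V X + entry_unit x) = eval_polynomial q X"
      using insert.IH[of ?\<psi>] by blast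
    obtain p where p: "\<And>X. \<phi> (Z V X) = eval_polynomial p X"
      using insert.IH[of \<phi>] insert.prems by blast
    obtain r where r: "\<And>X. eval_polynomial r X
        = eval_polynomial p X + X $ i $ j * (eval_polynomial q X - eval_polynomial p X)"
      using polynomial_function_combination[of p i j q] by metis
    \<comment> \<open>Since \<open>x\<close> is not in \<open>V\<close>, the entry of
      \<open>Z V X\<close> at \<open>x\<close> is 0.\<close>
    have "Z (insert x V) X = Z V X + X $ i $ j *\<^sub>R entry_unit x" for X
      using insert.hyps by (auto simp: vec_eq_iff Z_def entry_unit_component x)
    then have "\<phi> (Z (insert x V) X) = eval_polynomial r X" for X
      using insert.prems unfolding affine_in_entries_def r p[symmetric] q[symmetric] by metis
    then show ?case by blast
  qed
  from this[of UNIV] obtain p where "\<And>X. \<phi> (Z UNIV X) = eval_polynomial p X" by auto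
  moreover have "Z UNIV X = X" for X by (simp add: Z_def vec_eq_iff)
  ultimately have "\<phi> = eval_polynomial p" by auto
  then show ?thesis by (rule that)
qed

subsection \<open>Derivatives of polynomial functions\<close>

text \<open>Subtraction of exponents is truncated; when the exponent at \<open>(i, j)\<close> is 0,
  the factor in front is 0 as well.\<close>

lemma eval_monomial_has_field_derivative:
  "((\<lambda>t. eval_monomial m (X + t *\<^sub>R axis i (axis j 1))) has_field_derivative
     real (Poly_Mapping.lookup m (i, j)) * eval_monomial (m - Poly_Mapping.single (i, j) 1) X) (at 0)"
proof -
  let ?a = "Poly_Mapping.lookup m (i, j)"
  let ?R = "\<Prod>x\<in>UNIV - {(i, j)}. X $ fst x $ snd x ^ Poly_Mapping.lookup m x"
  have E: "axis i (axis j 1) = entry_unit (i, j)" by (simp add: entry_unit_def)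
  have 1: "eval_monomial m (X + t *\<^sub>R axis i (axis j 1)) = (X $ i $ j + t) ^ ?a * ?R" for t
    unfolding eval_monomial_split[of m _ i j] E
    by (intro arg_cong2[of _ _ _ _ "(*)"] prod.cong) (auto simp: entry_unit_component)
  have 2: "eval_monomial (m - Poly_Mapping.single (i, j) 1) X = X $ i $ j ^ (?a - 1) * ?R"
    unfolding eval_monomial_split[of _ X i j]
    by (intro arg_cong2[of _ _ _ _ "(*)"] prod.cong) (auto simp: lookup_minus lookup_single)
  show ?thesis unfolding 1 2
    by (auto intro!: derivative_eq_intros)
qed

text \<open>The result is again a sum indexed by \<open>A\<close>, with \<open>f\<close> possibly no
  longer injective, so the rule can be applied twice for second derivatives.\<close>

lemma pd_sum_monomials:
  "pd i j (\<lambda>X. \<Sum>a\<in>A. c a * eval_monomial (f a) X) =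
     (\<lambda>X. \<Sum>a\<in>A. c a * real (Poly_Mapping.lookup (f a) (i, j)) *
            eval_monomial (f a - Poly_Mapping.single (i, j) 1) X)"
  unfolding pd_def
  by (intro ext DERIV_imp_deriv)
    (auto intro!: derivative_eq_intros eval_monomial_has_field_derivative sum.cong)

section \<open>Homogeneous components and total weights of derivatives\<close>

lemma hom_component_eval:
  "hom_component d (eval_polynomial p) =
     (\<lambda>X. \<Sum>m\<in>{m \<in> Poly_Mapping.keys p. monomial_degree m = d}.
        Poly_Mapping.lookup p m * eval_monomial m X)"
  by (intro ext) (simp add: hom_component_def polynomial_of_eval)

lemma monomial_degree_le_total:
  assumes "m \<in> Poly_Mapping.keys p"
  shows "monomial_degree m \<le> total_degree (eval_polynomial p)"
  unfolding total_degree_def polynomial_of_eval using assms by (intro Max_ge) auto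

text \<open>Grouping by degree; the hypothesis on \<open>g\<close> accounts for the missing degree
  0.\<close>

lemma sum_hom_components:
  fixes g :: "('n::finite) monomial \<Rightarrow> real"
  assumes "\<And>m. monomial_degree m = 0 \<Longrightarrow> g m = 0"
  shows "(\<Sum>d = 1..total_degree (eval_polynomial p).
            \<Sum>m\<in>{m \<in> Poly_Mapping.keys p. monomial_degree m = d}. g m)
         = (\<Sum>m\<in>Poly_Mapping.keys p. g m)"
proof -
  let ?T = "total_degree (eval_polynomial p)"
  have "(\<Sum>m\<in>Poly_Mapping.keys p. g m)
      = (\<Sum>d\<in>{0..?T}. \<Sum>m\<in>{m \<in> Poly_Mapping.keys p. monomial_degree m = d}. g m)"
    by (rule sum.group[symmetric]) (auto intro: monomial_degree_le_total)
  also have "\<dots> = (\<Sum>d\<in>{1..?T}. \<Sum>m\<in>{m \<in> Poly_Mapping.keys p. monomial_degree m = d}. g m)"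
    by (rule sum.mono_neutral_right) (auto intro!: sum.neutral assms)
  finally show ?thesis by simp
qed

lemma sum_UNIV_prod:
  fixes h :: "'a::finite \<times> 'b::finite \<Rightarrow> 'c::comm_monoid_add"
  shows "(\<Sum>x\<in>UNIV. h x) = (\<Sum>i\<in>UNIV. \<Sum>j\<in>UNIV. h (i, j))"
  by (simp add: sum.cartesian_product case_prod_beta)

lemma sum_lookup: "(\<Sum>x\<in>UNIV. real (Poly_Mapping.lookup m x)) = real (monomial_degree m)"
  by (simp add: monomial_degree_def)

text \<open>If \<open>x\<close> occurs in \<open>m\<close>, removing one factor leaves a monomial of
  degree one less. Otherwise the outer factor is 0.\<close>

lemma sum_lookup_second:
  "(\<Sum>x\<in>UNIV. real (Poly_Mapping.lookup m x) *
      (\<Sum>y\<in>UNIV. real (Poly_Mapping.lookup (m - Poly_Mapping.single x 1) y)))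
   = real (monomial_degree m) * (real (monomial_degree m) - 1)"
proof -
  have *: "real (Poly_Mapping.lookup m x) *
        (\<Sum>y\<in>UNIV. real (Poly_Mapping.lookup (m - Poly_Mapping.single x 1) y))
      = real (Poly_Mapping.lookup m x) * (real (monomial_degree m) - 1)" for x
  proof (cases "Poly_Mapping.lookup m x = 0")
    case False
    then have "real (Poly_Mapping.lookup (m - Poly_Mapping.single x 1) y)
        = real (Poly_Mapping.lookup m y) - (if y = x then 1 else 0)" for y
      by (auto simp: lookup_minus lookup_single of_nat_diff)
    then show ?thesis by (simp add: sum_subtractf sum_lookup)
  qed simp
  show ?thesis
    by (simp only: *) (simp only: sum_distrib_right[symmetric] sum_lookup)
qed

subsection \<open>The bounds\<close>

text \<open>The weight \<open>d\<close> of the first derivatives cancels the \<open>d\<close> in the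
  normalisation and leaves \<open>1 / n\<close>. The result is given as a polynomial so that the
  bound can be iterated.\<close>

lemma D_op_eval:
  fixes p :: "('n::finite) polynomial"
  obtains q where "D_op (eval_polynomial p) = eval_polynomial q"
    and "coeff_norm q \<le> coeff_norm p / real CARD('n)"
proof -
  let ?K = "Poly_Mapping.keys p"
  let ?c = "\<lambda>(m, x). Poly_Mapping.lookup p m * real (Poly_Mapping.lookup m x)
              / (real (monomial_degree m) * real CARD('n))"
  let ?f = "\<lambda>(m, x). m - Poly_Mapping.single x 1"
  let ?q = "\<Sum>a\<in>?K \<times> UNIV. Poly_Mapping.single (?f a) (?c a)"
  have "D_op (eval_polynomial p) X = eval_polynomial ?q X" for X
  proof -
    have "D_hom d (hom_component d (eval_polynomial p)) X
        = (\<Sum>m\<in>{m \<in> ?K. monomial_degree m = d}. \<Sum>x\<in>UNIV. ?c (m, x) * eval_monomial (?f (m, x)) X)"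
      for d
    proof -
      have "D_hom d (hom_component d (eval_polynomial p)) X = 1 / (real d * real CARD('n)) *
          (\<Sum>x\<in>UNIV. \<Sum>m\<in>{m \<in> ?K. monomial_degree m = d}.
            Poly_Mapping.lookup p m * real (Poly_Mapping.lookup m x) * eval_monomial (?f (m, x)) X)"
        by (simp add: D_hom_def hom_component_eval pd_sum_monomials sum_UNIV_prod)
      also have "\<dots> = (\<Sum>m\<in>{m \<in> ?K. monomial_degree m = d}. \<Sum>x\<in>UNIV.
          ?c (m, x) * eval_monomial (?f (m, x)) X)"
        by (subst sum.swap) (auto simp: sum_distrib_left intro!: sum.cong)
      finally show ?thesis .
    qed
    then have "D_op (eval_polynomial p) X
        = (\<Sum>d = 1..total_degree (eval_polynomial p).
            \<Sum>m\<in>{m \<in> ?K. monomial_degree m = d}. \<Sum>x\<in>UNIV. ?c (m, x) * eval_monomial (?f (m, x)) X)"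
      by (simp add: D_op_def)
    also have "\<dots> = (\<Sum>m\<in>?K. \<Sum>x\<in>UNIV. ?c (m, x) * eval_monomial (?f (m, x)) X)"
      by (rule sum_hom_components) simp
    also have "\<dots> = eval_polynomial ?q X"
      unfolding eval_polynomial_sum_single[OF finite_cartesian_product[OF finite_keys finite]]
      by (simp add: sum.cartesian_product case_prod_beta)
    finally show ?thesis .
  qed
  moreover have "coeff_norm ?q \<le> coeff_norm p / real CARD('n)"
  proof -
    have "coeff_norm ?q \<le> (\<Sum>a\<in>?K \<times> UNIV. \<bar>?c a\<bar>)"
      by (rule coeff_norm_sum_single) simp
    also have "\<dots> = (\<Sum>m\<in>?K. \<Sum>x\<in>UNIV. \<bar>?c (m, x)\<bar>)"
      by (simp add: sum.cartesian_product case_prod_beta)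
    also have "\<dots> = (\<Sum>m\<in>?K. \<bar>Poly_Mapping.lookup p m\<bar> * real (monomial_degree m)
        / (real (monomial_degree m) * real CARD('n)))"
      by (simp add: abs_mult sum_divide_distrib[symmetric] sum_distrib_left[symmetric] sum_lookup del: of_nat_sum)
    \<comment> \<open>Equality except at a monomial of degree 0, where the left side is a quotient
      by 0 and hence 0.\<close>
    also have "\<dots> \<le> (\<Sum>m\<in>?K. \<bar>Poly_Mapping.lookup p m\<bar> / real CARD('n))"
      by (intro sum_mono) (auto simp: divide_simps)
    also have "\<dots> = coeff_norm p / real CARD('n)"
      by (simp add: coeff_norm_def sum_divide_distrib)
    finally show ?thesis .
  qed
  ultimately show ?thesis using that by blast
qed

lemma D_op_funpow_eval:
  fixes p :: "('n::finite) polynomial"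
  shows "\<exists>q. (D_op ^^ k) (eval_polynomial p) = eval_polynomial q \<and> coeff_norm q \<le> coeff_norm p"
proof (induction k)
  case (Suc k)
  then obtain q where q: "(D_op ^^ k) (eval_polynomial p) = eval_polynomial q"
    "coeff_norm q \<le> coeff_norm p" by blast
  obtain r where r: "D_op (eval_polynomial q) = eval_polynomial r"
    "coeff_norm r \<le> coeff_norm q / real CARD('n)" by (rule D_op_eval)
  have "0 \<le> coeff_norm q" by (simp add: coeff_norm_def sum_nonneg)
  moreover have "1 \<le> real CARD('n)" by (simp add: Suc_le_eq)
  ultimately have "coeff_norm q / real CARD('n) \<le> coeff_norm q"
    by (simp add: divide_le_eq mult_le_cancel_left1)
  with q r show ?case by (intro exI[of _ r]) simp
qed auto

section \<open>Estimates at permutation matrices\<close>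

lemma abs_entry_perm_matrix_le: "\<bar>perm_matrix \<sigma> $ i $ j\<bar> \<le> 1"
  by (simp add: perm_matrix_def)

lemma abs_eval_monomial_perm_matrix_le: "\<bar>eval_monomial m (perm_matrix \<sigma>)\<bar> \<le> 1"
  unfolding eval_monomial_def abs_prod
  by (intro prod_le_1) (auto simp: power_abs power_le_one abs_entry_perm_matrix_le)

lemma abs_eval_polynomial_perm_matrix_le:
  "\<bar>eval_polynomial p (perm_matrix \<sigma>)\<bar> \<le> coeff_norm p"
  unfolding eval_polynomial_def coeff_norm_def
  by (intro sum_abs[THEN order_trans] sum_mono)
    (simp add: abs_mult mult_left_le abs_eval_monomial_perm_matrix_le)

lemma sup_norm_le:
  assumes "\<And>\<sigma>. \<bar>\<phi> (perm_matrix \<sigma>)\<bar> \<le> C"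
  shows "sup_norm \<phi> \<le> C"
  unfolding sup_norm_def using assms by (subst Max_le_iff) (auto intro: permutes_id)

text \<open>The factors \<open>X $ i $ l * X $ k $ j\<close> have absolute value at most 1, so only
  the weight of the second derivatives counts. The quotient is left uncancelled: it is 0 at
  \<open>d = 0\<close>, where \<open>(d - 1) / n\<close> would be negative.\<close>

lemma abs_U_hom_perm_matrix_le:
  fixes p :: "('n::finite) polynomial"
  shows "\<bar>U_hom d (hom_component d (eval_polynomial p)) (perm_matrix \<sigma>)\<bar>
    \<le> (\<Sum>m\<in>{m \<in> Poly_Mapping.keys p. monomial_degree m = d}.
         \<bar>Poly_Mapping.lookup p m\<bar> * (real d * (real d - 1) / (real d * real CARD('n))))"
proof -
  let ?P = "perm_matrix \<sigma> :: real^'n^'n"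
  let ?K = "{m \<in> Poly_Mapping.keys p. monomial_degree m = d}"
  let ?g = "\<lambda>m x y. real (Poly_Mapping.lookup m x) *
      real (Poly_Mapping.lookup (m - Poly_Mapping.single x 1) y)"
  let ?e = "\<lambda>m x y. eval_monomial (m - Poly_Mapping.single x 1 - Poly_Mapping.single y 1) ?P"
  have "\<bar>\<Sum>i\<in>UNIV. \<Sum>j\<in>UNIV. \<Sum>k\<in>UNIV. \<Sum>l\<in>UNIV. ?P $ i $ l * ?P $ k $ j *
          pd i j (pd k l (hom_component d (eval_polynomial p))) ?P\<bar>
      \<le> (\<Sum>i\<in>UNIV. \<Sum>j\<in>UNIV. \<Sum>k\<in>UNIV. \<Sum>l\<in>UNIV. \<Sum>m\<in>?K.
          \<bar>Poly_Mapping.lookup p m\<bar> * ?g m (k, l) (i, j))"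
  proof (intro sum_abs[THEN order_trans] sum_mono)
    fix i j k l :: 'n
    have "\<bar>?P $ i $ l * ?P $ k $ j\<bar> \<le> 1"
      unfolding abs_mult by (intro mult_le_one abs_entry_perm_matrix_le) auto
    then have "\<bar>?P $ i $ l * ?P $ k $ j * pd i j (pd k l (hom_component d (eval_polynomial p))) ?P\<bar>
        \<le> \<bar>pd i j (pd k l (hom_component d (eval_polynomial p))) ?P\<bar>"
      unfolding abs_mult[of "_ * _"] by (intro mult_left_le_one_le) auto
    also have "\<dots> = \<bar>\<Sum>m\<in>?K. Poly_Mapping.lookup p m * ?g m (k, l) (i, j) * ?e m (k, l) (i, j)\<bar>"
      unfolding hom_component_eval pd_sum_monomials by (simp add: mult.assoc)
    also have "\<dots> \<le> (\<Sum>m\<in>?K. \<bar>Poly_Mapping.lookup p m\<bar> * ?g m (k, l) (i, j))"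
      by (intro sum_abs[THEN order_trans] sum_mono)
        (simp add: abs_mult mult_left_le abs_eval_monomial_perm_matrix_le)
    finally show "\<bar>?P $ i $ l * ?P $ k $ j * pd i j (pd k l (hom_component d (eval_polynomial p))) ?P\<bar>
        \<le> (\<Sum>m\<in>?K. \<bar>Poly_Mapping.lookup p m\<bar> * ?g m (k, l) (i, j))" .
  qed
  \<comment> \<open>Here \<open>x\<close> is the position \<open>(k, l)\<close> differentiated first
    and \<open>y\<close> is \<open>(i, j)\<close>.\<close>
  also have "\<dots> = (\<Sum>y\<in>UNIV. \<Sum>x\<in>UNIV. \<Sum>m\<in>?K. \<bar>Poly_Mapping.lookup p m\<bar> * ?g m x y)"
    by (simp only: sum_UNIV_prod)
  also have "\<dots> = (\<Sum>m\<in>?K. \<Sum>x\<in>UNIV. \<Sum>y\<in>UNIV. \<bar>Poly_Mapping.lookup p m\<bar> * ?g m x y)"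
    by (subst sum.swap, subst (2) sum.swap, subst sum.swap) (rule refl)
  also have "\<dots> = (\<Sum>m\<in>?K. \<bar>Poly_Mapping.lookup p m\<bar> * (real d * (real d - 1)))"
    by (simp only: sum_distrib_left[symmetric] sum_lookup_second) (auto intro!: sum.cong)
  finally have le: "\<bar>\<Sum>i\<in>UNIV. \<Sum>j\<in>UNIV. \<Sum>k\<in>UNIV. \<Sum>l\<in>UNIV. ?P $ i $ l * ?P $ k $ j *
          pd i j (pd k l (hom_component d (eval_polynomial p))) ?P\<bar>
      \<le> (\<Sum>m\<in>?K. \<bar>Poly_Mapping.lookup p m\<bar> * (real d * (real d - 1)))" .
  show ?thesis
    unfolding U_hom_def abs_mult[of "1 / _"] times_divide_eq_right[symmetric] sum_distrib_right[symmetric]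
    using divide_right_mono[OF le[unfolded sum_distrib_right[symmetric]], of "real d * real CARD('n)"]
    by (simp only: abs_divide abs_mult abs_of_nat abs_one times_divide_eq_left times_divide_eq_right
        mult_1_left) simp
qed

lemma abs_U_op_perm_matrix_le:
  fixes p :: "('n::finite) polynomial"
  assumes "total_degree (eval_polynomial p) \<ge> 1"
  shows "\<bar>U_op (eval_polynomial p) (perm_matrix \<sigma>)\<bar>
    \<le> (real (total_degree (eval_polynomial p)) - 1) / real CARD('n) * coeff_norm p"
proof -
  let ?T = "total_degree (eval_polynomial p)"
  let ?w = "\<lambda>d. real d * (real d - 1) / (real d * real CARD('n))"
  have "\<bar>U_op (eval_polynomial p) (perm_matrix \<sigma>)\<bar>
      \<le> (\<Sum>d = 1..?T. \<Sum>m\<in>{m \<in> Poly_Mapping.keys p. monomial_degree m = d}.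
           \<bar>Poly_Mapping.lookup p m\<bar> * ?w d)"
    unfolding U_op_def
    by (intro sum_abs[THEN order_trans] sum_mono abs_U_hom_perm_matrix_le)
  \<comment> \<open>The weight must depend on \<open>m\<close> alone before the degrees can be
    merged.\<close>
  also have "\<dots> = (\<Sum>d = 1..?T. \<Sum>m\<in>{m \<in> Poly_Mapping.keys p. monomial_degree m = d}.
           \<bar>Poly_Mapping.lookup p m\<bar> * ?w (monomial_degree m))"
    by (intro sum.cong) auto
  also have "\<dots> = (\<Sum>m\<in>Poly_Mapping.keys p. \<bar>Poly_Mapping.lookup p m\<bar> * ?w (monomial_degree m))"
    by (rule sum_hom_components) simp
  also have "\<dots> \<le> (\<Sum>m\<in>Poly_Mapping.keys p. \<bar>Poly_Mapping.lookup p m\<bar> * ((real ?T - 1) / real CARD('n)))"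
  proof (intro sum_mono mult_left_mono)
    fix m assume "m \<in> Poly_Mapping.keys p"
    then have "monomial_degree m \<le> ?T" by (rule monomial_degree_le_total)
    \<comment> \<open>At degree 0 the weight is 0, and the right side is nonnegative because the
      total degree is at least 1.\<close>
    then show "?w (monomial_degree m) \<le> (real ?T - 1) / real CARD('n)"
      using assms by (cases "monomial_degree m = 0") (simp_all add: divide_right_mono)
  qed simp
  also have "\<dots> = (real ?T - 1) / real CARD('n) * coeff_norm p"
    by (simp only: sum_distrib_right[symmetric] coeff_norm_def mult.commute)
  finally show ?thesis .
qed

lemma coeff_norm_le_max_times_num:
  "coeff_norm p \<le> max_coeff (eval_polynomial p) * real (num_monomials (eval_polynomial p))"
proof -
  have "coeff_norm p \<le> real (card (Poly_Mapping.keys p)) * max_coeff (eval_polynomial p)"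
    unfolding coeff_norm_def max_coeff_def polynomial_of_eval
    by (intro sum_bounded_above Max_ge) auto
  then show ?thesis by (simp add: num_monomials_def polynomial_of_eval mult.commute)
qed

theorem proposition1p1:
  fixes \<phi> :: "real^'n^'n \<Rightarrow> real" and d :: nat
  assumes "\<phi> \<in> FF"
    and "total_degree \<phi> = d"
    and "d \<ge> 1"
  shows "(\<forall>k::nat. sup_norm ((D_op ^^ k) \<phi>) \<le> 2 ^ k * max_coeff \<phi> * real (num_monomials \<phi>)) \<and>
         sup_norm (U_op \<phi>) \<le> (real d - 1) / real CARD('n) * max_coeff \<phi> * real (num_monomials \<phi>)"
proof -
  obtain p where p: "\<phi> = eval_polynomial p"
    using affine_in_entries_polynomial FF_affine_in_entries assms(1) by blast
  let ?MN = "max_coeff \<phi> * real (num_monomials \<phi>)"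
  have norm_le: "coeff_norm p \<le> ?MN"
    unfolding p by (rule coeff_norm_le_max_times_num)
  have norm_nonneg: "0 \<le> coeff_norm p" by (simp add: coeff_norm_def sum_nonneg)
  have "sup_norm ((D_op ^^ k) \<phi>) \<le> 2 ^ k * ?MN" for k
  proof -
    obtain q where q: "(D_op ^^ k) \<phi> = eval_polynomial q" "coeff_norm q \<le> coeff_norm p"
      using D_op_funpow_eval p by blast
    have "sup_norm ((D_op ^^ k) \<phi>) \<le> coeff_norm q"
      unfolding q(1) by (intro sup_norm_le abs_eval_polynomial_perm_matrix_le)
    also have "\<dots> \<le> 1 * ?MN" using q(2) norm_le by simp
    \<comment> \<open>The factor \<open>2 ^ k\<close> enters only here, through
      \<open>1 \<le> 2 ^ k\<close> and \<open>0 \<le> ?MN\<close>.\<close>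
    also have "\<dots> \<le> 2 ^ k * ?MN"
      using norm_le norm_nonneg by (intro mult_right_mono) auto
    finally show ?thesis .
  qed
  moreover have "sup_norm (U_op \<phi>) \<le> (real d - 1) / real CARD('n) * ?MN"
  proof -
    have "sup_norm (U_op \<phi>) \<le> (real d - 1) / real CARD('n) * coeff_norm p"
      using abs_U_op_perm_matrix_le assms(2,3) unfolding p by (intro sup_norm_le) blast
    also have "\<dots> \<le> (real d - 1) / real CARD('n) * ?MN"
      using norm_le assms(3) by (intro mult_left_mono) auto
    finally show ?thesis .
  qed
  ultimately show ?thesis by (simp add: mult.assoc)
qed

end
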